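(* Let $K$ be a field, $n$ a positive integer, $G$ a simple graph on $[n]=\{1,\ldots,n\}$, $S=K[X_i,Y_i\mid 1\le i\le n]$, and $I_G=\left([i,j]\mid\{i,j\}\text{ is an edge of }G\right)\subset S$, where $[i,j]=X_iY_j-Y_iX_j$. Let $v$ be a vertex around which $G$ is not complete. Then $$I_G=\left(I_G+(X_v,Y_v)\right)\cap\left(I_G+I_2(N_G(v))\right).$$
   Context: A simple graph has no loops and no multiple edges. $d_G(x,y)$ denotes the graph distance in $G$ (the minimal length of a path joining $x$ and $y$, or $\infty$ if there is none). $N_G(v)=\{x\mid d_G(x,v)=1\}$ is the neighborhood of $v$. $G$ is complete around $v$ if $d_G(x,y)\le 1$ for all $x,y\in N_G(v)$. For a subset $A\subset[n]$, $I_2(A)$ denotes the ideal $([a,b]\mid a,b\in A)$ of $S$. *)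

theory Defs
  imports
    "HOL-Library.Poly_Mapping"
    "HOL-Library.Extended_Nat"
    "HOL-Algebra.Ideal"
    "Graph_Theory.Pair_Digraph"
    "Graph_Theory.Arc_Walk"
begin

section \<open>Graphs\<close>

text \<open>
  A simple graph is a \<^locale>\<open>pair_graph\<close>: a finite loop-free digraph whose arcs are vertex pairs
  and whose arc set is symmetric. The edge \<open>{i,j}\<close> corresponds to the two arcs \<open>(i,j)\<close> and
  \<open>(j,i)\<close>.
\<close>

text \<open>An infimum in \<^typ>\<open>enat\<close> is attained, unless the set is empty, when it is \<open>\<infinity>\<close>.\<close>

definition graph_dist :: "'a pair_pre_digraph \<Rightarrow> 'a \<Rightarrow> 'a \<Rightarrow> enat" where
  "graph_dist G x y = (INF p \<in> {p. pre_digraph.apath (with_proj G) x p y}. enat (length p))"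

definition neighborhood :: "'a pair_pre_digraph \<Rightarrow> 'a \<Rightarrow> 'a set" where
  "neighborhood G v = {x \<in> pverts G. graph_dist G x v = 1}"

definition complete_around :: "'a pair_pre_digraph \<Rightarrow> 'a \<Rightarrow> bool" where
  "complete_around G v \<longleftrightarrow>
     (\<forall>x \<in> neighborhood G v. \<forall>y \<in> neighborhood G v. graph_dist G x y \<le> 1)"


section \<open>The polynomial ring\<close>

datatype pvar = XV nat | YV nat

text \<open>
  Power products are finitely supported exponent functions, and polynomials are finitely supported
  coefficient functions on power products. The type has variables for all natural indices; the
  ring over \<open>[n]\<close> is cut out by its carrier.
\<close>

type_synonym 'k pvar_poly = "(pvar \<Rightarrow>\<^sub>0 nat) \<Rightarrow>\<^sub>0 'k"

definition poly_X :: "nat \<Rightarrow> 'k::field pvar_poly" where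
  "poly_X i = Poly_Mapping.single (Poly_Mapping.single (XV i) 1) 1"

definition poly_Y :: "nat \<Rightarrow> 'k::field pvar_poly" where
  "poly_Y i = Poly_Mapping.single (Poly_Mapping.single (YV i) 1) 1"

definition poly_ring :: "nat \<Rightarrow> 'k::field pvar_poly ring" where
  "poly_ring n =
     \<lparr>carrier = {p. \<forall>m \<in> Poly_Mapping.keys p. Poly_Mapping.keys m \<subseteq> XV ` {1..n} \<union> YV ` {1..n}},
      monoid.mult = (*), one = 1, zero = 0, add = (+)\<rparr>"

lemma poly_ring_cring: "cring (poly_ring n :: 'k::field pvar_poly ring)"
proof -
  let ?V = "XV ` {1..n} \<union> YV ` {1..n}"
  let ?P = "\<lambda>p::'k pvar_poly. \<forall>m \<in> Poly_Mapping.keys p. Poly_Mapping.keys m \<subseteq> ?V"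
  have add: "?P (p + q)" if "?P p" "?P q" for p q
    using that Poly_Mapping.keys_add[of p q] by blast
  have neg: "?P (- p)" if "?P p" for p
    using that by simp
  have mult: "?P (p * q)" if "?P p" "?P q" for p q
  proof
    fix m assume "m \<in> Poly_Mapping.keys (p * q)"
    then obtain a b where "m = a + b" "a \<in> Poly_Mapping.keys p" "b \<in> Poly_Mapping.keys q"
      using keys_mult[of p q] by blast
    then show "Poly_Mapping.keys m \<subseteq> ?V"
      using that Poly_Mapping.keys_add[of a b] by blast
  qed
  have one: "?P 1"
    by (simp flip: single_one)
  let ?S = "poly_ring n :: 'k pvar_poly ring"
  have ops: "carrier ?S = {p. ?P p}" "\<And>p q. p \<otimes>\<^bsub>?S\<^esub> q = p * q" "\<And>p q. p \<oplus>\<^bsub>?S\<^esub> q = p + q"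
      "\<one>\<^bsub>?S\<^esub> = 1" "\<zero>\<^bsub>?S\<^esub> = 0"
    by (simp_all add: poly_ring_def)
  have "abelian_group ?S"
  proof (rule abelian_groupI, goal_cases)
    case (6 p)
    then show ?case
      unfolding ops using neg[of p] by (intro bexI[of _ "- p"]) simp_all
  qed (unfold ops mem_Collect_eq, (rule add; assumption) | simp add: ac_simps)+
  moreover have "comm_monoid ?S"
    by (rule comm_monoidI)
       (unfold ops mem_Collect_eq, (rule mult; assumption) | (rule one) | simp add: ac_simps)+
  ultimately show ?thesis
    by (rule cringI) (simp add: ops distrib_right)
qed

lemma poly_X_Y_in_carrier:
  assumes "i \<in> {1..n}"
  shows "poly_X i \<in> carrier (poly_ring n)" "poly_Y i \<in> carrier (poly_ring n)"
  using assms by (simp_all add: poly_ring_def poly_X_def poly_Y_def)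


section \<open>Ideals\<close>

definition bracket :: "nat \<Rightarrow> nat \<Rightarrow> 'k::field pvar_poly" where
  "bracket i j = poly_X i * poly_Y j - poly_Y i * poly_X j"

definition edge_ideal :: "nat \<Rightarrow> nat pair_pre_digraph \<Rightarrow> 'k::field pvar_poly set" where
  "edge_ideal n G = Idl\<^bsub>poly_ring n\<^esub> {bracket i j | i j. (i, j) \<in> parcs G}"

definition I2 :: "nat \<Rightarrow> nat set \<Rightarrow> 'k::field pvar_poly set" where
  "I2 n A = Idl\<^bsub>poly_ring n\<^esub> {bracket a b | a b. a \<in> A \<and> b \<in> A}"

end

theory Submission
  imports Defs
begin

text \<open>
  Write \<open>R'\<close> for the polynomials not involving \<open>X\<^sub>v, Y\<^sub>v\<close>, so that
  \<open>S = R' \<oplus> (X\<^sub>v, Y\<^sub>v)\<close>. For neighbours \<open>a, b\<close> of \<open>v\<close> the Pluecker-type identity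
  \<open>X\<^sub>v [a,b] = X\<^sub>a [v,b] - X\<^sub>b [v,a]\<close>, and likewise for \<open>Y\<^sub>v\<close>, shows that
  \<open>(X\<^sub>v, Y\<^sub>v)\<close> multiplies \<open>I\<^sub>2(N(v))\<close> into \<open>I\<^sub>G\<close>; hence every element \<open>f\<close> of
  \<open>I\<^sub>G + I\<^sub>2(N(v))\<close> is congruent modulo \<open>I\<^sub>G\<close> to some \<open>r \<in> R'\<close>. If also
  \<open>f \<in> I\<^sub>G + (X\<^sub>v, Y\<^sub>v)\<close>, then \<open>r\<close> lies in this ideal, which equals
  \<open>(I\<^sub>G \<inter> R') \<oplus> (X\<^sub>v, Y\<^sub>v)\<close> because each generator of \<open>I\<^sub>G\<close> lies in one of the two
  summands. Therefore \<open>r \<in> I\<^sub>G\<close>.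
\<close>

section \<open>Distance one and adjacency\<close>

lemma graph_dist_eq_one_imp_arc:
  assumes "pair_graph G" and "graph_dist G x y = 1"
  shows "(x, y) \<in> parcs G"
proof -
  interpret pair_graph G by fact
  let ?P = "{p. apath x p y}"
  \<comment> \<open>Over the empty set the infimum would be \<open>\<infinity>\<close>. Once the set
    is nonempty, well-ordering of \<open>enat\<close> makes the infimum attained, here by a path
    consisting of one arc.\<close>
  have "?P \<noteq> {}"
  proof
    assume "?P = {}"
    then have "graph_dist G x y = \<infinity>"
      unfolding graph_dist_def by (simp only: image_empty) (simp add: top_enat_def)
    then show False using assms(2) by simp
  qed
  then have "(INF p \<in> ?P. enat (length p)) \<in> (\<lambda>p. enat (length p)) ` ?P"
    by (metis image_is_empty ex_in_conv wellorder_InfI)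
  then obtain p where p: "apath x p y" and "enat (length p) = 1"
    using assms(2) unfolding graph_dist_def by auto
  then obtain e where "p = [e]"
    by (auto simp: one_enat_def length_Suc_conv)
  with p show ?thesis
    by (cases e) (auto simp: apath_def awalk_simps)
qed

section \<open>Subrings of polynomials in a given set of variables\<close>

text \<open>The parameter \<open>V\<close> lets one set of closure rules serve both the carrier of
  \<open>poly_ring n\<close> and its subring \<open>R'\<close> without the variables of
  \<open>v\<close>.\<close>

definition polys_over :: "pvar set \<Rightarrow> 'k::field pvar_poly set" where
  "polys_over V = {p. \<forall>m \<in> Poly_Mapping.keys p. Poly_Mapping.keys m \<subseteq> V}"

lemma polys_over_mono: "V \<subseteq> W \<Longrightarrow> polys_over V \<subseteq> polys_over W"
  unfolding polys_over_def by blast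

lemma polys_over_zero [simp]: "0 \<in> polys_over V"
  by (simp add: polys_over_def)

lemma polys_over_one [simp]: "1 \<in> polys_over V"
  by (simp add: polys_over_def flip: single_one)

lemma polys_over_add: "p \<in> polys_over V \<Longrightarrow> q \<in> polys_over V \<Longrightarrow> p + q \<in> polys_over V"
  unfolding polys_over_def using Poly_Mapping.keys_add[of p q] by blast

lemma polys_over_uminus: "p \<in> polys_over V \<Longrightarrow> - p \<in> polys_over V"
  by (simp add: polys_over_def)

lemma polys_over_diff: "p \<in> polys_over V \<Longrightarrow> q \<in> polys_over V \<Longrightarrow> p - q \<in> polys_over V"
  using polys_over_add[of p V "- q"] polys_over_uminus[of q V] by simp

lemma polys_over_mult:
  assumes "p \<in> polys_over V" "q \<in> polys_over V"
  shows "p * q \<in> polys_over V"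
  unfolding polys_over_def mem_Collect_eq
proof
  fix m assume "m \<in> Poly_Mapping.keys (p * q)"
  then obtain a b where "m = a + b" "a \<in> Poly_Mapping.keys p" "b \<in> Poly_Mapping.keys q"
    using keys_mult[of p q] by blast
  then show "Poly_Mapping.keys m \<subseteq> V"
    using assms Poly_Mapping.keys_add[of a b] unfolding polys_over_def by blast
qed

lemmas polys_over_closed =
  polys_over_add polys_over_uminus polys_over_diff polys_over_mult

lemma polys_over_X: "XV i \<in> V \<Longrightarrow> poly_X i \<in> polys_over V"
  by (simp add: polys_over_def poly_X_def)

lemma polys_over_Y: "YV i \<in> V \<Longrightarrow> poly_Y i \<in> polys_over V"
  by (simp add: polys_over_def poly_Y_def)

lemma polys_over_bracket:
  "{XV i, YV i, XV j, YV j} \<subseteq> V \<Longrightarrow> bracket i j \<in> polys_over V"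
  unfolding bracket_def by (auto intro!: polys_over_closed polys_over_X polys_over_Y)

section \<open>Splitting off the two variables of a vertex\<close>

lemma sum_monomials:
  fixes p :: "'a \<Rightarrow>\<^sub>0 'b::comm_monoid_add"
  shows "(\<Sum>m\<in>Poly_Mapping.keys p. Poly_Mapping.single m (Poly_Mapping.lookup p m)) = p"
  by (rule poly_mapping_eqI)
     (auto simp: lookup_sum lookup_single when_def in_keys_iff sum.delta)

text \<open>The cofactor has the exponent of \<open>u\<close> lowered by one. Subtraction of
  exponents is truncated, so it can be undone only because \<open>u\<close> occurs in
  \<open>m\<close>.\<close>

lemma monomial_split_variable:
  fixes m :: "pvar \<Rightarrow>\<^sub>0 nat" and c :: "'k::field"
  assumes "u \<in> Poly_Mapping.keys m" "Poly_Mapping.keys m \<subseteq> V"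
  shows "\<exists>q \<in> polys_over V.
    Poly_Mapping.single m c = Poly_Mapping.single (Poly_Mapping.single u 1) 1 * q"
proof
  let ?m' = "m - Poly_Mapping.single u 1"
  have "Poly_Mapping.keys ?m' \<subseteq> V"
    using assms(2) by (auto simp: in_keys_iff lookup_minus)
  then show "Poly_Mapping.single ?m' c \<in> polys_over V"
    by (simp add: polys_over_def)
  have "m = Poly_Mapping.single u 1 + ?m'"
    using assms(1)
    by (intro poly_mapping_eqI) (auto simp: lookup_add lookup_minus lookup_single when_def in_keys_iff)
  then show "Poly_Mapping.single m c =
      Poly_Mapping.single (Poly_Mapping.single u 1) 1 * Poly_Mapping.single ?m' c"
    by (simp add: mult_single)
qed

text \<open>The property is additive, so monomials suffice: one that avoids both variables goes into
  \<open>r\<close>, any other is divisible by \<open>poly_X v\<close> or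
  \<open>poly_Y v\<close>.\<close>

lemma polys_over_decomp:
  fixes p :: "'k::field pvar_poly"
  assumes "p \<in> polys_over V"
  shows "\<exists>r \<in> polys_over (V - {XV v, YV v}). \<exists>x \<in> polys_over V. \<exists>y \<in> polys_over V.
    p = r + poly_X v * x + poly_Y v * y"
    (is "?D p")
proof -
  have add: "?D (p + q)" if p: "?D p" and q: "?D q" for p q :: "'k pvar_poly"
  proof -
    obtain r x y where 1: "r \<in> polys_over (V - {XV v, YV v})" "x \<in> polys_over V"
      "y \<in> polys_over V" "p = r + poly_X v * x + poly_Y v * y" using p by blast
    obtain r' x' y' where 2: "r' \<in> polys_over (V - {XV v, YV v})" "x' \<in> polys_over V"
      "y' \<in> polys_over V" "q = r' + poly_X v * x' + poly_Y v * y'" using q by blast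
    have "p + q = (r + r') + poly_X v * (x + x') + poly_Y v * (y + y')"
      unfolding 1 2 by (simp add: algebra_simps)
    then show ?thesis using 1 2 polys_over_add by meson
  qed
  have mono: "?D (Poly_Mapping.single m c)" if m: "Poly_Mapping.keys m \<subseteq> V" for m and c :: 'k
  proof (cases "Poly_Mapping.keys m \<inter> {XV v, YV v} = {}")
    case True
    then have "Poly_Mapping.single m c \<in> polys_over (V - {XV v, YV v})"
      using m by (auto simp: polys_over_def)
    then show ?thesis
      by (rule bexI[rotated]) (intro bexI[of _ 0]; simp)
  next
    case False
    then consider "XV v \<in> Poly_Mapping.keys m" | "YV v \<in> Poly_Mapping.keys m" by blast
    then show ?thesis
    proof cases
      case 1
      then obtain q :: "'k pvar_poly"
        where "q \<in> polys_over V" "Poly_Mapping.single m c = poly_X v * q"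
        using monomial_split_variable[OF _ m, of _ c] unfolding poly_X_def by blast
      then show ?thesis
        by (intro bexI[of _ 0] bexI[of _ q]) simp_all
    next
      case 2
      then obtain q :: "'k pvar_poly"
        where q: "q \<in> polys_over V" "Poly_Mapping.single m c = poly_Y v * q"
        using monomial_split_variable[OF _ m, of _ c] unfolding poly_Y_def by blast
      then show ?thesis
        by (intro bexI[of _ 0] bexI[of _ q]) simp_all
    qed
  qed
  have "?D (\<Sum>m\<in>A. Poly_Mapping.single m (Poly_Mapping.lookup p m))"
    if "finite A" "A \<subseteq> Poly_Mapping.keys p" for A
    using that
  proof (induction A rule: finite_induct)
    case empty
    show ?case by (intro bexI[of _ 0]) simp_all
  next
    case (insert m A)
    then have "Poly_Mapping.keys m \<subseteq> V" "?D (\<Sum>m\<in>A. Poly_Mapping.single m (Poly_Mapping.lookup p m))"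
      using assms unfolding polys_over_def by blast+
    then show ?case
      unfolding sum.insert[OF insert.hyps] by (intro add mono)
  qed
  from this[of "Poly_Mapping.keys p"] show ?thesis
    by (simp add: sum_monomials)
qed

lemma keys_mult_variable:
  fixes q :: "'k::field pvar_poly"
  assumes "m \<in> Poly_Mapping.keys (Poly_Mapping.single (Poly_Mapping.single u 1) 1 * q)"
  shows "u \<in> Poly_Mapping.keys m"
proof -
  obtain b where "m = Poly_Mapping.single u 1 + b"
    using assms keys_mult[of "Poly_Mapping.single (Poly_Mapping.single u 1) (1 :: 'k)" q] by auto
  then show ?thesis
    by (simp add: in_keys_iff lookup_add)
qed

text \<open>Directness of the decomposition: every monomial of the combination contains
  \<open>XV v\<close> or \<open>YV v\<close>, while the assumption forbids both, so no monomial is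
  left.\<close>

lemma polys_over_inter_variable_ideal:
  fixes x y :: "'k::field pvar_poly"
  assumes "poly_X v * x + poly_Y v * y \<in> polys_over (V - {XV v, YV v})"
  shows "poly_X v * x + poly_Y v * y = 0"
proof -
  let ?p = "poly_X v * x + poly_Y v * y"
  have "m \<notin> Poly_Mapping.keys ?p" for m
  proof
    assume m: "m \<in> Poly_Mapping.keys ?p"
    then have "m \<in> Poly_Mapping.keys (poly_X v * x) \<union> Poly_Mapping.keys (poly_Y v * y)"
      using Poly_Mapping.keys_add[of "poly_X v * x" "poly_Y v * y"] by blast
    then have "XV v \<in> Poly_Mapping.keys m \<or> YV v \<in> Poly_Mapping.keys m"
      using keys_mult_variable unfolding poly_X_def poly_Y_def by blast
    then show False
      using assms m unfolding polys_over_def by blast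
  qed
  then show ?thesis
    by (metis equals0I keys_eq_empty)
qed

section \<open>The ring over \<open>[n]\<close> and its ideals\<close>

definition variables :: "nat \<Rightarrow> pvar set" where
  "variables n = XV ` {1..n} \<union> YV ` {1..n}"

lemma poly_ring_simps [simp]:
  "carrier (poly_ring n) = polys_over (variables n)"
  "p \<otimes>\<^bsub>poly_ring n\<^esub> q = p * q"
  "p \<oplus>\<^bsub>poly_ring n\<^esub> q = p + q"
  "\<one>\<^bsub>poly_ring n\<^esub> = 1"
  "\<zero>\<^bsub>poly_ring n\<^esub> = 0"
  by (simp_all add: poly_ring_def polys_over_def variables_def)

lemma ideal_poly_ringI:
  fixes J :: "'k::field pvar_poly set"
  assumes "J \<subseteq> polys_over (variables n)" and "0 \<in> J"
    and add: "\<And>p q. p \<in> J \<Longrightarrow> q \<in> J \<Longrightarrow> p + q \<in> J"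
    and mult: "\<And>h p. h \<in> polys_over (variables n) \<Longrightarrow> p \<in> J \<Longrightarrow> h * p \<in> J"
  shows "ideal J (poly_ring n)"
proof -
  interpret cring "poly_ring n :: 'k pvar_poly ring" by (rule poly_ring_cring)
  have "\<ominus>\<^bsub>poly_ring n\<^esub> p \<in> J" if "p \<in> J" for p
  proof -
    have "- p \<in> J" using mult[of "- 1" p] that by (simp add: polys_over_uminus)
    \<comment> \<open>The additive inverse of the ring record is specified abstractly; uniqueness of
      inverses identifies it with the minus of the type.\<close>
    moreover have "\<ominus>\<^bsub>poly_ring n\<^esub> p = - p"
      using assms(1) that by (intro sum_zero_eq_neg[symmetric]) (auto intro: polys_over_uminus)
    ultimately show ?thesis by simp
  qed
  then have "additive_subgroup J (poly_ring n)"
    using assms unfolding additive_subgroup_def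
    by (intro add.subgroupI) (auto simp: a_inv_def)
  moreover have "p * h \<in> J" if "h \<in> polys_over (variables n)" "p \<in> J" for h p
    using mult[OF that] by (simp add: mult.commute)
  ultimately show ?thesis
    using mult by (intro idealI ring_axioms) (auto simp: additive_subgroup_def)
qed

lemma ideal_poly_ringD:
  fixes J :: "'k::field pvar_poly set"
  assumes "ideal J (poly_ring n)"
  shows "J \<subseteq> polys_over (variables n)"
    and "0 \<in> J"
    and "\<And>p q. p \<in> J \<Longrightarrow> q \<in> J \<Longrightarrow> p + q \<in> J"
    and "\<And>h p. h \<in> polys_over (variables n) \<Longrightarrow> p \<in> J \<Longrightarrow> h * p \<in> J"
    and "\<And>p q. p \<in> J \<Longrightarrow> q \<in> J \<Longrightarrow> p - q \<in> J"
proof -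
  interpret ideal J "poly_ring n" by fact
  show "J \<subseteq> polys_over (variables n)" using a_subset by simp
  show "0 \<in> J" using additive_subgroup.zero_closed[OF is_additive_subgroup] by simp
  show add: "p + q \<in> J" if "p \<in> J" "q \<in> J" for p q using additive_subgroup.a_closed[OF is_additive_subgroup that] by simp
  show mult: "h * p \<in> J" if "h \<in> polys_over (variables n)" "p \<in> J" for h p
    using I_l_closed[of p h] that by simp
  show "p - q \<in> J" if "p \<in> J" "q \<in> J" for p q
    using add[of p "- 1 * q"] mult[of "- 1" q] that by (simp add: polys_over_uminus)
qed

lemma ideal_add_iff:
  fixes I J :: "'k::field pvar_poly set"
  shows "f \<in> I <+>\<^bsub>poly_ring n\<^esub> J \<longleftrightarrow> (\<exists>g \<in> I. \<exists>h \<in> J. f = g + h)"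
  by (simp add: set_add_def' image_iff)

section \<open>The Pluecker relation and the intersection formula\<close>

text \<open>Each identity expands a vanishing 3 by 3 determinant with columns \<open>v\<close>,
  \<open>a\<close>, \<open>b\<close> and a repeated row of X's or Y's. If \<open>a\<close> and
  \<open>b\<close> are neighbours of \<open>v\<close>, both brackets on the right come from
  edges.\<close>

lemma variable_mult_bracket:
  "poly_X v * bracket a b = poly_X a * bracket v b - poly_X b * bracket v a"
  "poly_Y v * bracket a b = poly_Y a * bracket v b - poly_Y b * bracket v a"
  by (simp_all add: bracket_def algebra_simps)

theorem lemma4p8:
  fixes n v :: nat and G :: "nat pair_pre_digraph"
  assumes "n \<ge> 1"
    and "pair_graph G" and "pverts G = {1..n}"
    and "v \<in> {1..n}"
    and "\<not> complete_around G v"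
  shows "(edge_ideal n G :: 'k::field pvar_poly set) =
    (edge_ideal n G <+>\<^bsub>poly_ring n\<^esub> Idl\<^bsub>poly_ring n\<^esub> {poly_X v, poly_Y v}) \<inter>
    (edge_ideal n G <+>\<^bsub>poly_ring n\<^esub> I2 n (neighborhood G v))"
proof -
  interpret G: pair_graph G by fact
  interpret R: cring "poly_ring n :: 'k pvar_poly ring" by (rule poly_ring_cring)
  define C :: "'k pvar_poly set" where "C = polys_over (variables n)"
  define R' :: "'k pvar_poly set" where "R' = polys_over (variables n - {XV v, YV v})"
  define I :: "'k pvar_poly set" where "I = edge_ideal n G"
  define M :: "'k pvar_poly set" where "M = Idl\<^bsub>poly_ring n\<^esub> {poly_X v, poly_Y v}"
  define N :: "'k pvar_poly set" where "N = I2 n (neighborhood G v)"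
  let ?X = "poly_X v :: 'k pvar_poly" and ?Y = "poly_Y v :: 'k pvar_poly"

  note closed = polys_over_closed[where 'a = 'k and V = "variables n", folded C_def]
  note closed' = polys_over_closed[where 'a = 'k and V = "variables n - {XV v, YV v}", folded R'_def]
  have R'_C: "R' \<subseteq> C"
    unfolding R'_def C_def by (intro polys_over_mono) blast
  have X_C: "poly_X i \<in> C" and Y_C: "poly_Y i \<in> C" if "i \<in> {1..n}" for i
    using that unfolding C_def variables_def by (auto intro: polys_over_X polys_over_Y)
  have br_C: "bracket i j \<in> C" if "i \<in> {1..n}" "j \<in> {1..n}" for i j
    using that unfolding C_def variables_def by (auto intro: polys_over_bracket)
  have br_R': "bracket i j \<in> R'" if "i \<in> {1..n}" "j \<in> {1..n}" "i \<noteq> v" "j \<noteq> v" for i j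
    using that unfolding R'_def variables_def by (auto intro: polys_over_bracket)
  have arc_n: "i \<in> {1..n}" "j \<in> {1..n}" if "(i, j) \<in> parcs G" for i j
    using that G.in_arcsD1 G.in_arcsD2 assms(3) by auto
  \<comment> \<open>The fact \<open>a \<noteq> v\<close>, from the absence of loops, later places
    brackets of neighbours in \<open>R'\<close>.\<close>
  have nb: "(v, a) \<in> parcs G" "a \<in> {1..n}" "a \<noteq> v" if "a \<in> neighborhood G v" for a
  proof -
    have av: "(a, v) \<in> parcs G"
      using that graph_dist_eq_one_imp_arc[OF assms(2)] unfolding neighborhood_def by auto
    then show "(v, a) \<in> parcs G" "a \<in> {1..n}"
      using G.arcs_symmetric arc_n by blast+
    show "a \<noteq> v" using av G.no_loops[of "(a, v)"] by auto
  qed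
  have decomp: "\<exists>r \<in> R'. \<exists>x \<in> C. \<exists>y \<in> C. p = r + ?X * x + ?Y * y" if "p \<in> C" for p
    using polys_over_decomp that unfolding R'_def C_def by blast

  have edges_C: "{bracket i j | i j. (i, j) \<in> parcs G} \<subseteq> C"
    using arc_n br_C by blast
  have nbrs_C: "{bracket a b | a b. a \<in> neighborhood G v \<and> b \<in> neighborhood G v} \<subseteq> C"
    using nb br_C by blast
  have I_ideal: "ideal I (poly_ring n)" and M_ideal: "ideal M (poly_ring n)"
    and N_ideal: "ideal N (poly_ring n)"
    unfolding I_def M_def N_def edge_ideal_def I2_def
    using edges_C nbrs_C X_C[OF assms(4)] Y_C[OF assms(4)]
    by (simp_all add: R.genideal_ideal flip: C_def)
  note I = ideal_poly_ringD[OF I_ideal, folded C_def]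
  have edge_I: "bracket i j \<in> I" if "(i, j) \<in> parcs G" for i j
    using R.genideal_self[of "{bracket i j | i j. (i, j) \<in> parcs G}"] edges_C that
    unfolding I_def edge_ideal_def C_def by auto

  \<comment> \<open>\<open>T\<close> is the sum of \<open>R' \<inter> I\<close> and the ideal of
    \<open>X\<^sub>v, Y\<^sub>v\<close>, with explicit coefficients. Once it is known to be an
    ideal, inspecting generators puts \<open>I\<close> and \<open>M\<close> inside it.\<close>
  define T where "T = {s + ?X * x + ?Y * y | s x y. s \<in> R' \<inter> I \<and> x \<in> C \<and> y \<in> C}"
  have TI: "p \<in> T" if "p = s + ?X * x + ?Y * y" "s \<in> R'" "s \<in> I" "x \<in> C" "y \<in> C" for p s x y
    using that unfolding T_def by blast
  have C0: "0 \<in> C" and C1: "1 \<in> C" and R0: "0 \<in> R'"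
    unfolding C_def R'_def by simp_all
  have T_ideal: "ideal T (poly_ring n)"
  proof (rule ideal_poly_ringI, unfold C_def[symmetric])
    show "T \<subseteq> C"
      unfolding T_def using X_C[OF assms(4)] Y_C[OF assms(4)]
      by (auto intro!: closed intro: subsetD[OF R'_C])
    show "0 \<in> T"
      by (rule TI[of _ 0 0 0]) (simp_all add: C0 R0 I(2))
  next
    fix p q assume "p \<in> T" "q \<in> T"
    then obtain s x y s' x' y' where *: "p = s + ?X * x + ?Y * y" "q = s' + ?X * x' + ?Y * y'"
      "s \<in> R'" "s \<in> I" "x \<in> C" "y \<in> C" "s' \<in> R'" "s' \<in> I" "x' \<in> C" "y' \<in> C"
      unfolding T_def by blast
    have "p + q = (s + s') + ?X * (x + x') + ?Y * (y + y')"
      unfolding *(1,2) by (simp add: algebra_simps)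
    then show "p + q \<in> T"
      by (rule TI) (use * in \<open>auto intro: closed(1) closed'(1) I(3)\<close>)
  next
    fix h p assume h: "h \<in> C" and "p \<in> T"
    then obtain s x y where *: "p = s + ?X * x + ?Y * y" "s \<in> R'" "s \<in> I" "x \<in> C" "y \<in> C"
      unfolding T_def by blast
    obtain r x' y' where **: "h = r + ?X * x' + ?Y * y'" "r \<in> R'" "x' \<in> C" "y' \<in> C"
      using decomp h by blast
    \<comment> \<open>Only the part \<open>r\<close> of \<open>h\<close> multiplies \<open>s\<close>
      into \<open>R' \<inter> I\<close>; every other term carries a factor \<open>X\<^sub>v\<close>
      or \<open>Y\<^sub>v\<close>.\<close>
    have "h * p = r * s + ?X * (x' * s + h * x) + ?Y * (y' * s + h * y)"
      unfolding *(1) by (simp add: **(1) algebra_simps)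
    moreover have "s \<in> C" using *(2) R'_C by blast
    moreover have "r \<in> C" using **(2) R'_C by blast
    ultimately show "h * p \<in> T"
      using *(2-5) **(2-4) h by (intro TI[of "h * p"]) (assumption | rule closed closed' I(4))+
  qed
  have "I \<subseteq> T"
    unfolding I_def edge_ideal_def
  proof (rule R.genideal_minimal[OF T_ideal], safe)
    fix i j assume ij: "(i, j) \<in> parcs G"
    note n = arc_n[OF ij]
    \<comment> \<open>For an edge avoiding \<open>v\<close> the bracket is its own
      \<open>R' \<inter> I\<close> part. For an edge at \<open>v\<close> that part is 0 and the
      coefficients are, up to sign, the variables of the other endpoint.\<close>
    show "bracket i j \<in> T"
    proof (cases "i = v \<or> j = v")
      case False
      then show ?thesis
        using n ij by (intro TI[of _ "bracket i j" 0 0]) (auto intro: br_R' edge_I C0)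
    next
      case True
      then show ?thesis
      proof
        assume "i = v"
        then show ?thesis using n
          by (intro TI[of _ 0 "poly_Y j" "- poly_X j"])
             (auto simp: bracket_def R0 I(2) intro!: closed X_C Y_C)
      next
        assume "j = v"
        then show ?thesis using n
          by (intro TI[of _ 0 "- poly_Y i" "poly_X i"])
             (auto simp: bracket_def R0 I(2) algebra_simps intro!: closed X_C Y_C)
      qed
    qed
  qed
  moreover have "M \<subseteq> T"
    unfolding M_def
  proof (rule R.genideal_minimal[OF T_ideal], safe)
    show "?X \<in> T" by (rule TI[of _ 0 1 0]) (auto simp: C0 C1 R0 I(2))
    show "?Y \<in> T" by (rule TI[of _ 0 0 1]) (auto simp: C0 C1 R0 I(2))
  qed
  ultimately have IM_T: "I <+>\<^bsub>poly_ring n\<^esub> M \<subseteq> T"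
    using ideal_poly_ringD(3)[OF T_ideal] unfolding subset_iff ideal_add_iff by blast

  \<comment> \<open>The property wanted for \<open>N\<close> is the last one, congruence modulo
    \<open>I\<close> to an element of \<open>R'\<close>. Alone it need not survive multiplication by
    \<open>h\<close>; the first two conditions make the \<open>X\<^sub>v\<close> and
    \<open>Y\<^sub>v\<close> parts of \<open>h\<close> act as zero modulo \<open>I\<close>.\<close>
  define J where "J = {f \<in> C. ?X * f \<in> I \<and> ?Y * f \<in> I \<and> (\<exists>r \<in> R'. f - r \<in> I)}"
  have J_ideal: "ideal J (poly_ring n)"
  proof (rule ideal_poly_ringI, unfold C_def[symmetric])
    show "J \<subseteq> C" unfolding J_def by blast
    show "0 \<in> J" unfolding J_def using R0 C0 I(2) by (auto intro!: bexI[of _ 0])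
  next
    fix p q assume "p \<in> J" "q \<in> J"
    then obtain r s where *: "r \<in> R'" "s \<in> R'" "p - r \<in> I" "q - s \<in> I"
      and **: "p \<in> C" "q \<in> C" "?X * p \<in> I" "?Y * p \<in> I" "?X * q \<in> I" "?Y * q \<in> I"
      unfolding J_def by blast
    have "p + q - (r + s) \<in> I" using I(3)[OF *(3,4)] by (simp add: algebra_simps)
    moreover have "r + s \<in> R'" using * by (intro closed')
    moreover have "p + q \<in> C" using ** by (intro closed)
    moreover have "?X * (p + q) \<in> I" "?Y * (p + q) \<in> I"
      unfolding distrib_left using ** by (simp_all add: I(3))
    ultimately show "p + q \<in> J" unfolding J_def by blast
  next
    fix h p assume h: "h \<in> C" and "p \<in> J"
    then obtain r where r: "r \<in> R'" "p - r \<in> I"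
      and p: "p \<in> C" "?X * p \<in> I" "?Y * p \<in> I"
      unfolding J_def by blast
    obtain s x y where s: "h = s + ?X * x + ?Y * y" "s \<in> R'" "x \<in> C" "y \<in> C"
      using decomp h by blast
    have "h * p - s * r = s * (p - r) + x * (?X * p) + y * (?Y * p)"
      unfolding s(1) by (simp add: algebra_simps)
    also have "\<dots> \<in> I"
      using I(4)[OF _ r(2), of s] I(4)[OF s(3) p(2)] I(4)[OF s(4) p(3)] s(2) R'_C
      by (simp add: I(3) subsetD)
    finally have "h * p - s * r \<in> I" .
    moreover have "s * r \<in> R'" using r s by (intro closed')
    moreover have "h * p \<in> C" using h p(1) by (intro closed)
    moreover have "?X * (h * p) \<in> I" "?Y * (h * p) \<in> I"
      unfolding mult.left_commute[of _ h] using h p(2,3) by (simp_all add: I(4))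
    ultimately show "h * p \<in> J" unfolding J_def by blast
  qed
  have N_J: "N \<subseteq> J"
    unfolding N_def I2_def
  proof (rule R.genideal_minimal[OF J_ideal], safe)
    fix a b assume "a \<in> neighborhood G v" "b \<in> neighborhood G v"
    note ab = nb[OF this(1)] nb[OF this(2)]
    \<comment> \<open>The Pluecker relation gives the first two conditions; for the third,
      \<open>bracket a b\<close> avoids \<open>v\<close> and represents itself.\<close>
    have "?X * bracket a b \<in> I" "?Y * bracket a b \<in> I"
    unfolding variable_mult_bracket[of v a b] using ab by (simp_all only: I(4,5) edge_I X_C Y_C)
    moreover have "bracket a b - bracket a b \<in> I" using I(2) by simp
    ultimately show "bracket a b \<in> J"
      unfolding J_def using ab br_R' br_C by blast
  qed

  have "f \<in> I" if f: "f \<in> I <+>\<^bsub>poly_ring n\<^esub> M" "f \<in> I <+>\<^bsub>poly_ring n\<^esub> N" for f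
  proof -
    obtain g h where gh: "g \<in> I" "h \<in> N" "f = g + h"
      using f(2) by (auto simp: ideal_add_iff)
    then obtain r where r: "r \<in> R'" "h - r \<in> I"
      using N_J unfolding J_def by blast
    have fr: "f - r \<in> I" using I(3)[OF gh(1) r(2)] gh(3) by (simp add: algebra_simps)
    \<comment> \<open>This difference is \<open>r\<close>, written so that both terms visibly lie in
      \<open>T\<close>: \<open>f\<close> through \<open>I + M\<close>, and \<open>f - r\<close>
      through \<open>I\<close>.\<close>
    have "f - (f - r) \<in> T"
      by (rule ideal_poly_ringD(5)[OF T_ideal]) (use IM_T f(1) \<open>I \<subseteq> T\<close> fr in blast)+
    then obtain s x y where s: "r = s + ?X * x + ?Y * y" "s \<in> R'" "s \<in> I"
      unfolding T_def by auto
    \<comment> \<open>Both \<open>r\<close> and \<open>s\<close> avoid the variables of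
      \<open>v\<close>, so directness forces this combination to vanish, and \<open>r\<close> equals
      \<open>s\<close>, an element of \<open>I\<close>.\<close>
    have "r - s = ?X * x + ?Y * y" using s(1) by (simp add: algebra_simps)
    moreover have "r - s \<in> R'" using r s by (intro closed')
    ultimately have "r - s = 0"
      using polys_over_inter_variable_ideal[of v x y] unfolding R'_def by simp
    then have "r \<in> I" using s(3) by simp
    then show "f \<in> I" using I(3)[OF fr, of r] by simp
  qed
  moreover have "I \<subseteq> I <+>\<^bsub>poly_ring n\<^esub> L" if "ideal L (poly_ring n)" for L
    using ideal_poly_ringD(2)[OF that] by (force simp: ideal_add_iff)
  ultimately have "I = (I <+>\<^bsub>poly_ring n\<^esub> M) \<inter> (I <+>\<^bsub>poly_ring n\<^esub> N)"
    using M_ideal N_ideal by blast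
  then show ?thesis unfolding I_def M_def N_def .
qed

end
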